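(* For any prime power $q\equiv 3\pmod 4$, \[ \operatorname{ex}\big(q+1,\{1234,1235,1245\}\big)=\frac{q+1}{16}\binom{q+1}{3}. \]
   Context: For a $4$-uniform hypergraph $F$ and an integer $n$, $\operatorname{ex}(n,F)$ denotes the maximum number of hyperedges in a $4$-uniform hypergraph on $n$ vertices containing no copy (not necessarily induced) of $F$. Here $\{1234,1235,1245\}$ denotes the $4$-uniform hypergraph on vertex set $\{1,2,3,4,5\}$ with hyperedges $\{1,2,3,4\},\{1,2,3,5\},\{1,2,4,5\}$ (up to isomorphism, the unique $4$-uniform hypergraph on $5$ vertices with $3$ hyperedges). *)

theory Defs
  imports Complex_Main "HOL-Number_Theory.Cong" "HOL-Number_Theory.Prime_Powers"
begin

text \<open>A hypergraph is a pair of a vertex set and a set of hyperedges.\<close>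

type_synonym 'a hypergraph = "'a set \<times> 'a set set"

definition verts :: "'a hypergraph \<Rightarrow> 'a set" where
  "verts H = fst H"

definition hyperedges :: "'a hypergraph \<Rightarrow> 'a set set" where
  "hyperedges H = snd H"

definition uniform_hypergraph :: "nat \<Rightarrow> 'a hypergraph \<Rightarrow> bool" where
  "uniform_hypergraph r H \<longleftrightarrow>
     finite (verts H) \<and> (\<forall>e \<in> hyperedges H. e \<subseteq> verts H \<and> card e = r)"

text \<open>Copies are not necessarily induced: hyperedges are only required to map to hyperedges.\<close>

definition contains_copy :: "'a hypergraph \<Rightarrow> 'b hypergraph \<Rightarrow> bool" where
  "contains_copy H F \<longleftrightarrow>
     (\<exists>f. inj_on f (verts F) \<and> f ` verts F \<subseteq> verts H \<and>
          (\<forall>e \<in> hyperedges F. f ` e \<in> hyperedges H))"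

text \<open>The vertices are natural numbers without loss of generality, since every finite hypergraph
  has an isomorphic copy there.\<close>

definition ex_sizes :: "nat \<Rightarrow> nat \<Rightarrow> 'b hypergraph \<Rightarrow> nat set" where
  "ex_sizes r n F =
     {card (hyperedges H) | H :: nat hypergraph.
        uniform_hypergraph r H \<and> card (verts H) = n \<and> \<not> contains_copy H F}"

definition ex_number :: "nat \<Rightarrow> nat \<Rightarrow> 'b hypergraph \<Rightarrow> nat" where
  "ex_number r n F = Max (ex_sizes r n F)"

definition F53 :: "nat hypergraph" where
  "F53 = ({1, 2, 3, 4, 5}, {{1, 2, 3, 4}, {1, 2, 3, 5}, {1, 2, 4, 5}})"

lemma finite_ex_sizes: "finite (ex_sizes r n F)"
proof (rule finite_subset)
  show "ex_sizes r n F \<subseteq> {.. n choose r}"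
  proof
    fix m assume "m \<in> ex_sizes r n F"
    then obtain H :: "nat hypergraph" where H: "m = card (hyperedges H)"
      "uniform_hypergraph r H" "card (verts H) = n"
      unfolding ex_sizes_def by blast
    have fin: "finite (verts H)" and
      sub: "hyperedges H \<subseteq> {e. e \<subseteq> verts H \<and> card e = r}"
      using H(2) by (auto simp: uniform_hypergraph_def)
    have "card (hyperedges H) \<le> card {e. e \<subseteq> verts H \<and> card e = r}"
      using fin by (intro card_mono sub) (rule finite_subset[of _ "Pow (verts H)"], auto)
    also have "\<dots> = n choose r"
      using n_subsets[OF fin] H(3) by simp
    finally show "m \<in> {.. n choose r}" using H(1) by simp
  qed
qed simp

lemma ex_sizes_nonempty:
  assumes "hyperedges F \<noteq> {}"
  shows "ex_sizes r n F \<noteq> {}"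
proof -
  have "uniform_hypergraph r ({..<n}, {})" "card (verts ({..<n}, {})) = n"
    "\<not> contains_copy ({..<n}, {}) F"
    using assms by (auto simp: uniform_hypergraph_def contains_copy_def verts_def hyperedges_def)
  then show ?thesis unfolding ex_sizes_def by blast
qed

end

theory Submission
  imports Defs "HOL-Analysis.Convex" "HOL-Computational_Algebra.Polynomial"
begin

text \<open>
  Upper bound: in an \<open>F53\<close>-free hypergraph the codegrees of the four triples in an edge sum to at
  most the number \<open>n\<close> of vertices, so the sum over all triples of the squared codegrees is at most
  \<open>n\<close> times the number of edges, and Cauchy--Schwarz gives the bound.

  Lower bound: let \<open>S\<close> be the bordered Paley matrix of order \<open>q + 1\<close>, a skew matrix of signs
  with orthogonal rows since \<open>q \<equiv> 3 (mod 4)\<close>. Take as edges the quadruples whose \<open>4 \<times> 4\<close> principal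
  Pfaffian is \<open>\<plusminus>3\<close>. A copy of \<open>F53\<close> would yield three numbers \<open>S a x * S b x\<close> whose pairwise
  products are \<open>-1\<close>, which is impossible for signs, and orthogonality of the rows makes every codegree
  equal to \<open>(q + 1) / 4\<close>. The field with \<open>q\<close> elements is realised as a residue field of the ring
  generated by the complex \<open>(q - 1)\<close>-th roots of unity.
\<close>

section \<open>The upper bound\<close>

lemma verts_F53: "verts F53 = {1, 2, 3, 4, 5}"
  by (simp add: verts_def F53_def)

lemma hyperedges_F53: "hyperedges F53 = {{1, 2, 3, 4}, {1, 2, 3, 5}, {1, 2, 4, 5}}"
  by (simp add: hyperedges_def F53_def)

text \<open>The three edges share the pair \<open>a\<close>, \<open>b\<close>; each omits one of
  \<open>c\<close>, \<open>d\<close>, \<open>e\<close>.\<close>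

lemma contains_copy_F53_iff:
  "contains_copy H F53 \<longleftrightarrow>
     (\<exists>a b c d e. distinct [a, b, c, d, e] \<and> {a, b, c, d, e} \<subseteq> verts H \<and>
        {{a, b, c, d}, {a, b, c, e}, {a, b, d, e}} \<subseteq> hyperedges H)"
proof
  assume "contains_copy H F53"
  then obtain f where inj: "inj_on f (verts F53)" and V: "f ` verts F53 \<subseteq> verts H"
    and E: "\<forall>e\<in>hyperedges F53. f ` e \<in> hyperedges H"
    unfolding contains_copy_def by blast
  have "distinct [f 1, f 2, f 3, f 4, f 5]"
    using inj by (simp add: verts_F53)
  moreover have "{f 1, f 2, f 3, f 4, f 5} \<subseteq> verts H"
    using V by (simp add: verts_F53)
  moreover have "{{f 1, f 2, f 3, f 4}, {f 1, f 2, f 3, f 5}, {f 1, f 2, f 4, f 5}} \<subseteq> hyperedges H"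
    using E by (simp add: hyperedges_F53)
  ultimately show "\<exists>a b c d e. distinct [a, b, c, d, e] \<and> {a, b, c, d, e} \<subseteq> verts H \<and>
        {{a, b, c, d}, {a, b, c, e}, {a, b, d, e}} \<subseteq> hyperedges H"
    by meson
next
  assume "\<exists>a b c d e. distinct [a, b, c, d, e] \<and> {a, b, c, d, e} \<subseteq> verts H \<and>
        {{a, b, c, d}, {a, b, c, e}, {a, b, d, e}} \<subseteq> hyperedges H"
  then obtain a b c d e where *: "distinct [a, b, c, d, e]" "{a, b, c, d, e} \<subseteq> verts H"
    "{{a, b, c, d}, {a, b, c, e}, {a, b, d, e}} \<subseteq> hyperedges H"
    by (elim exE conjE)
  define f where "f = (\<lambda>i::nat. [a, b, c, d, e] ! (i - 1))"
  have f: "f 1 = a" "f (Suc 0) = a" "f 2 = b" "f 3 = c" "f 4 = d" "f 5 = e"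
    by (simp_all add: f_def)
  have "inj_on f (verts F53)"
    using *(1) by (simp add: f verts_F53)
  moreover have "f ` verts F53 \<subseteq> verts H"
    using *(2) by (simp add: f verts_F53)
  moreover have "\<forall>e\<in>hyperedges F53. f ` e \<in> hyperedges H"
    using *(3) by (simp add: f hyperedges_F53)
  ultimately show "contains_copy H F53"
    unfolding contains_copy_def by blast
qed

section \<open>Codegrees of triples and their double counting\<close>

definition codegree_set :: "'a set \<Rightarrow> 'a set set \<Rightarrow> 'a set \<Rightarrow> 'a set" where
  "codegree_set V E T = {x \<in> V - T. insert x T \<in> E}"

definition triples :: "'a set \<Rightarrow> 'a set set" where
  "triples V = {T. T \<subseteq> V \<and> card T = 3}"

lemma finite_triples [simp]: "finite V \<Longrightarrow> finite (triples V)"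
  unfolding triples_def by (rule finite_subset[of _ "Pow V"]) auto

lemma card_triples: "finite V \<Longrightarrow> card (triples V) = card V choose 3"
  unfolding triples_def by (rule n_subsets)

text \<open>Both sides sum over edges with a marked vertex, the triple being the rest of the edge.
  The weight is general because \<open>f = 1\<close> gives the total codegree and \<open>f\<close>
  equal to the codegree gives the sum of squares.\<close>

lemma sum_triples_codegree:
  fixes f :: "'a set \<Rightarrow> 'b::comm_semiring_1"
  assumes "finite V" and E: "\<And>e. e \<in> E \<Longrightarrow> e \<subseteq> V \<and> card e = 4"
  shows "(\<Sum>T\<in>triples V. f T * of_nat (card (codegree_set V E T))) = (\<Sum>e\<in>E. \<Sum>x\<in>e. f (e - {x}))"
proof -
  have finE: "finite E" "\<And>e. e \<in> E \<Longrightarrow> finite e"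
    using assms by (auto intro: finite_subset[of E "Pow V"] finite_subset[of _ V])
  have "(\<Sum>T\<in>triples V. f T * of_nat (card (codegree_set V E T)))
      = (\<Sum>T\<in>triples V. \<Sum>x\<in>codegree_set V E T. f T)"
    by (simp add: mult.commute)
  also have "\<dots> = (\<Sum>(T, x)\<in>Sigma (triples V) (codegree_set V E). f T)"
    using \<open>finite V\<close> by (intro sum.Sigma) (auto simp: codegree_set_def)
  also have "\<dots> = (\<Sum>(e, x)\<in>Sigma E (\<lambda>e. e). f (e - {x}))"
  proof (rule sum.reindex_bij_witness
      [of _ "\<lambda>(e, x). (e - {x}, x)" "\<lambda>(T, x). (insert x T, x)"])
    fix p assume "p \<in> Sigma E (\<lambda>e. e)"
    then obtain e x where p: "p = (e, x)" "e \<in> E" "x \<in> e"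
      by auto
    then show "(case p of (e, x) \<Rightarrow> (e - {x}, x)) \<in> Sigma (triples V) (codegree_set V E)"
      using E[of e] by (auto simp: triples_def codegree_set_def insert_absorb card_Diff_singleton_if)
  qed (auto simp: codegree_set_def)
  also have "\<dots> = (\<Sum>e\<in>E. \<Sum>x\<in>e. f (e - {x}))"
    using finE by (intro sum.Sigma[symmetric]) auto
  finally show ?thesis .
qed

lemma sum_codegree:
  assumes "finite V" "\<And>e. e \<in> E \<Longrightarrow> e \<subseteq> V \<and> card e = 4"
  shows "(\<Sum>T\<in>triples V. card (codegree_set V E T)) = 4 * card E"
  using sum_triples_codegree[OF assms, where f = "\<lambda>_. 1::nat"] assms(2) by simp

text \<open>A vertex in two of these codegree sets lies outside \<open>e\<close>, and then two further edges
  on the same five vertices complete a copy of \<open>F53\<close>.\<close>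

lemma sum_codegree_edge_le:
  assumes "uniform_hypergraph 4 H" "\<not> contains_copy H F53" "e \<in> hyperedges H"
  shows "(\<Sum>x\<in>e. card (codegree_set (verts H) (hyperedges H) (e - {x}))) \<le> card (verts H)"
proof -
  let ?D = "\<lambda>x. codegree_set (verts H) (hyperedges H) (e - {x})"
  have fin: "finite (verts H)" and e: "e \<subseteq> verts H" "card e = 4"
    using assms by (auto simp: uniform_hypergraph_def)
  have fine: "finite e"
    using e(2) card.infinite by fastforce
  have disj: "?D x \<inter> ?D y = {}" if xy: "x \<in> e" "y \<in> e" "x \<noteq> y" for x y
  proof (rule ccontr)
    assume "?D x \<inter> ?D y \<noteq> {}"
    then obtain z where z: "z \<in> verts H" "z \<notin> e"
      "insert z (e - {x}) \<in> hyperedges H" "insert z (e - {y}) \<in> hyperedges H"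
      using xy by (auto simp: codegree_set_def)
    have "card (e - {x, y}) = 2"
      using xy e(2) fine by (simp add: card_Diff_subset)
    then obtain a b where ab: "e - {x, y} = {a, b}" "a \<noteq> b"
      by (meson card_2_iff)
    have eq: "e = {a, b, x, y}" "e - {x} = {a, b, y}" "e - {y} = {a, b, x}"
      using ab xy by blast+
    have "distinct [a, b, x, y, z]"
      using ab xy z(2) by auto
    moreover have "{{a, b, x, y}, {a, b, x, z}, {a, b, y, z}} \<subseteq> hyperedges H"
      using z(3,4)[unfolded eq(2,3)] assms(3)[unfolded eq(1)] by (simp add: insert_commute)
    moreover have "{a, b, x, y, z} \<subseteq> verts H"
      using z(1) e(1) unfolding eq(1) by simp
    ultimately have "contains_copy H F53"
      unfolding contains_copy_F53_iff by meson
    with assms(2) show False ..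
  qed
  have "(\<Sum>x\<in>e. card (?D x)) = card (\<Union>x\<in>e. ?D x)"
    using fin fine disj
    by (intro card_UN_disjoint[symmetric]) (auto simp: codegree_set_def)
  also have "\<dots> \<le> card (verts H)"
    using fin by (intro card_mono) (auto simp: codegree_set_def)
  finally show ?thesis .
qed

lemma card_hyperedges_le:
  assumes "uniform_hypergraph 4 H" "\<not> contains_copy H F53"
  shows "16 * card (hyperedges H) \<le> card (verts H) * (card (verts H) choose 3)"
proof (cases "card (hyperedges H) = 0")
  case False
  let ?V = "verts H" and ?E = "hyperedges H"
  let ?d = "\<lambda>T. card (codegree_set ?V ?E T)"
  have fin: "finite ?V" and E: "\<And>e. e \<in> ?E \<Longrightarrow> e \<subseteq> ?V \<and> card e = 4"
    using assms by (auto simp: uniform_hypergraph_def)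
  have "(\<Sum>T\<in>triples ?V. (?d T)\<^sup>2) = (\<Sum>e\<in>?E. \<Sum>x\<in>e. ?d (e - {x}))"
    using sum_triples_codegree[OF fin E, where f = ?d] by (simp add: power2_eq_square)
  also have "\<dots> \<le> card ?E * card ?V"
    using sum_bounded_above[of ?E "\<lambda>e. \<Sum>x\<in>e. ?d (e - {x})" "card ?V"]
      sum_codegree_edge_le[OF assms] by simp
  finally have sq: "(\<Sum>T\<in>triples ?V. (?d T)\<^sup>2) \<le> card ?E * card ?V" .
  \<comment> \<open>Each edge contains four triples, so the codegrees sum to
    \<open>4 * card ?E\<close>. After Cauchy-Schwarz a factor \<open>card ?E\<close> is cancelled,
    hence the case split.\<close>
  have "(4 * real (card ?E))\<^sup>2 = (\<Sum>T\<in>triples ?V. real (?d T))\<^sup>2"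
    using sum_codegree[OF fin E] by (metis of_nat_mult of_nat_numeral of_nat_sum)
  also have "\<dots> \<le> (\<Sum>T\<in>triples ?V. (real (?d T))\<^sup>2) * real (card (triples ?V))"
    by (rule sum_squared_le_sum_of_squares)
  also have "\<dots> \<le> real (card ?E * card ?V) * real (card ?V choose 3)"
    using of_nat_mono[OF sq, where 'a = real] fin by (intro mult_mono) (simp_all add: card_triples)
  finally have "real (card ?E * (16 * card ?E)) \<le> real (card ?E * (card ?V * (card ?V choose 3)))"
    by (simp add: power2_eq_square algebra_simps)
  then have "card ?E * (16 * card ?E) \<le> card ?E * (card ?V * (card ?V choose 3))"
    by (simp only: of_nat_le_iff)
  with False show ?thesis
    by simp
qed simp

section \<open>Skew conference matrices\<close>

text \<open>In matrix terms, \<open>S\<close> is skew and S S^T = (n - 1) I, where n is the order;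
  the diagonal of the product is forced by the sign condition.\<close>

definition skew_conference :: "'a set \<Rightarrow> ('a \<Rightarrow> 'a \<Rightarrow> int) \<Rightarrow> bool" where
  "skew_conference I S \<longleftrightarrow> finite I \<and>
     (\<forall>i\<in>I. S i i = 0) \<and>
     (\<forall>i\<in>I. \<forall>j\<in>I. S j i = - S i j) \<and>
     (\<forall>i\<in>I. \<forall>j\<in>I. i \<noteq> j \<longrightarrow> \<bar>S i j\<bar> = 1) \<and>
     (\<forall>i\<in>I. \<forall>j\<in>I. i \<noteq> j \<longrightarrow> (\<Sum>k\<in>I. S i k * S j k) = 0)"

text \<open>For skew \<open>S\<close> its square is the determinant of the principal submatrix on
  \<open>a\<close>, \<open>b\<close>, \<open>c\<close>, \<open>d\<close>; for sign entries it is a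
  sum of three signs.\<close>

definition pfaffian4 :: "('a \<Rightarrow> 'a \<Rightarrow> int) \<Rightarrow> 'a \<Rightarrow> 'a \<Rightarrow> 'a \<Rightarrow> 'a \<Rightarrow> int" where
  "pfaffian4 S a b c d = S a b * S c d - S a c * S b d + S a d * S b c"

definition pfaffian_edges :: "'a set \<Rightarrow> ('a \<Rightarrow> 'a \<Rightarrow> int) \<Rightarrow> 'a set set" where
  "pfaffian_edges I S = {{a, b, c, d} | a b c d.
     {a, b, c, d} \<subseteq> I \<and> distinct [a, b, c, d] \<and> \<bar>pfaffian4 S a b c d\<bar> = 3}"

section \<open>The hypergraph of quadruples with Pfaffian \<plusminus>3\<close>

context
  fixes I :: "'a set" and S :: "'a \<Rightarrow> 'a \<Rightarrow> int"
  assumes S: "skew_conference I S"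
begin

lemma skew_facts:
  shows "finite I"
    and "i \<in> I \<Longrightarrow> S i i = 0"
    and "i \<in> I \<Longrightarrow> j \<in> I \<Longrightarrow> S j i = - S i j"
    and "i \<in> I \<Longrightarrow> j \<in> I \<Longrightarrow> i \<noteq> j \<Longrightarrow> S i j = 1 \<or> S i j = -1"
    and "i \<in> I \<Longrightarrow> j \<in> I \<Longrightarrow> i \<noteq> j \<Longrightarrow> (\<Sum>k\<in>I. S i k * S j k) = 0"
proof -
  show "i \<in> I \<Longrightarrow> j \<in> I \<Longrightarrow> i \<noteq> j \<Longrightarrow> S i j = 1 \<or> S i j = -1"
    using S unfolding skew_conference_def by (metis abs_if minus_equation_iff)
qed (use S in \<open>unfold skew_conference_def, blast+\<close>)

text \<open>A permutation of the indices multiplies the Pfaffian by its sign, so the absolute value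
  depends only on the set. All assignments of the primed indices are checked.\<close>

lemma abs_pfaffian4_cong:
  assumes "{a, b, c, d} \<subseteq> I" "distinct [a, b, c, d]" "distinct [a', b', c', d']"
    and eq: "{a', b', c', d'} = {a, b, c, d}"
  shows "\<bar>pfaffian4 S a' b' c' d'\<bar> = \<bar>pfaffian4 S a b c d\<bar>"
proof -
  note skew = skew_facts(3)[of a b] skew_facts(3)[of a c] skew_facts(3)[of a d]
    skew_facts(3)[of b c] skew_facts(3)[of b d] skew_facts(3)[of c d]
  have "a' \<in> {a, b, c, d}" "b' \<in> {a, b, c, d}" "c' \<in> {a, b, c, d}" "d' \<in> {a, b, c, d}"
    using eq by auto
  then have "(a' = a \<or> a' = b \<or> a' = c \<or> a' = d) \<and> (b' = a \<or> b' = b \<or> b' = c \<or> b' = d) \<and>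
     (c' = a \<or> c' = b \<or> c' = c \<or> c' = d) \<and> (d' = a \<or> d' = b \<or> d' = c \<or> d' = d)"
    by blast
  then show ?thesis
    using assms(1,2,3)
    by (elim conjE disjE; simp add: pfaffian4_def skew; simp add: algebra_simps abs_if)
qed

lemma insert_in_pfaffian_edges_iff:
  assumes "{a, b, c, d} \<subseteq> I" "distinct [a, b, c, d]"
  shows "{a, b, c, d} \<in> pfaffian_edges I S \<longleftrightarrow> \<bar>pfaffian4 S a b c d\<bar> = 3"
proof
  assume "{a, b, c, d} \<in> pfaffian_edges I S"
  then obtain a' b' c' d' where "{a', b', c', d'} = {a, b, c, d}" "distinct [a', b', c', d']"
    "\<bar>pfaffian4 S a' b' c' d'\<bar> = 3"
    by (auto simp: pfaffian_edges_def)
  with abs_pfaffian4_cong[OF assms] show "\<bar>pfaffian4 S a b c d\<bar> = 3"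
    by metis
next
  assume "\<bar>pfaffian4 S a b c d\<bar> = 3"
  with assms show "{a, b, c, d} \<in> pfaffian_edges I S"
    unfolding pfaffian_edges_def by blast
qed

lemma pfaffian_edges_subset: "e \<in> pfaffian_edges I S \<Longrightarrow> e \<subseteq> I \<and> card e = 4"
  by (auto simp: pfaffian_edges_def)

text \<open>Three signs sum to \<plusminus>3 only if they agree. In particular
  \<open>- S a c * S b d\<close> and \<open>S a d * S b c\<close> agree, so their product is
  1.\<close>

lemma abs_pfaffian4_eq_3D:
  assumes "{a, b, c, d} \<subseteq> I" "distinct [a, b, c, d]" "\<bar>pfaffian4 S a b c d\<bar> = 3"
  shows "S a c * S b c * (S a d * S b d) = -1"
proof -
  have "S a b = 1 \<or> S a b = -1" "S a c = 1 \<or> S a c = -1" "S a d = 1 \<or> S a d = -1"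
    "S b c = 1 \<or> S b c = -1" "S b d = 1 \<or> S b d = -1" "S c d = 1 \<or> S c d = -1"
    using assms by (simp_all add: skew_facts(4))
  with assms(3) show ?thesis
    by (elim disjE; simp add: pfaffian4_def)
qed

lemma pfaffian_edges_F53_free: "\<not> contains_copy (I, pfaffian_edges I S) F53"
proof
  assume "contains_copy (I, pfaffian_edges I S) F53"
  then obtain a b c d e where D: "distinct [a, b, c, d, e]" and I: "{a, b, c, d, e} \<subseteq> I"
    and E: "{a, b, c, d} \<in> pfaffian_edges I S" "{a, b, c, e} \<in> pfaffian_edges I S"
      "{a, b, d, e} \<in> pfaffian_edges I S"
    unfolding contains_copy_F53_iff by (auto simp: verts_def hyperedges_def)
  have "S a c * S b c * (S a d * S b d) = -1" "S a c * S b c * (S a e * S b e) = -1"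
    "S a d * S b d * (S a e * S b e) = -1"
    using D I E by (auto intro!: abs_pfaffian4_eq_3D simp flip: insert_in_pfaffian_edges_iff)
  \<comment> \<open>Each \<open>S a x * S b x\<close> with x among \<open>c\<close>,
    \<open>d\<close>, \<open>e\<close> occurs in two of the three products, so multiplying them
    gives a square.\<close>
  then have "(S a c * S b c * (S a d * S b d)) * (S a c * S b c * (S a e * S b e))
      * (S a d * S b d * (S a e * S b e)) = -1"
    by simp
  moreover have "(S a c * S b c * (S a d * S b d)) * (S a c * S b c * (S a e * S b e))
      * (S a d * S b d * (S a e * S b e)) = (S a c * S b c * S a d * S b d * S a e * S b e)\<^sup>2"
    by (simp add: power2_eq_square algebra_simps)
  ultimately show False
    by (metis zero_le_power2 neg_0_le_iff_le not_one_le_zero)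
qed

text \<open>As \<open>d\<close> varies, the Pfaffian is a combination of three orthogonal rows of squared norm
  \<open>card I - 1\<close>; it vanishes on \<open>T\<close> and is \<open>\<plusminus>1\<close> or \<open>\<plusminus>3\<close> elsewhere.\<close>

lemma card_codegree_pfaffian_edges:
  assumes T: "T \<in> triples I"
  shows "4 * card (codegree_set I (pfaffian_edges I S) T) = card I"
proof -
  obtain a b c where abc: "T = {a, b, c}" "a \<noteq> b" "a \<noteq> c" "b \<noteq> c"
    using T by (auto simp: triples_def card_3_iff)
  have mem: "a \<in> I" "b \<in> I" "c \<in> I"
    using T abc by (auto simp: triples_def)
  let ?C = "codegree_set I (pfaffian_edges I S) T" and ?v = "pfaffian4 S a b c"
  have fin: "finite I"
    by (rule skew_facts)
  have cardI: "card I = card (I - T) + 3"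
    using abc mem fin card_mono[OF fin, of T] by (simp add: card_Diff_subset)
  have C: "?C = {d \<in> I - T. \<bar>?v d\<bar> = 3}"
    unfolding codegree_set_def
  proof (intro Collect_cong conj_cong refl)
    fix d assume "d \<in> I - T"
    then have "{a, b, c, d} \<in> pfaffian_edges I S \<longleftrightarrow> \<bar>?v d\<bar> = 3"
      using abc mem by (intro insert_in_pfaffian_edges_iff) auto
    then show "insert d T \<in> pfaffian_edges I S \<longleftrightarrow> \<bar>?v d\<bar> = 3"
      by (simp add: abc(1) insert_commute)
  qed
  have norm: "(\<Sum>d\<in>I. S i d * S i d) = int (card I) - 1" if "i \<in> I" for i
  proof -
    have "(\<Sum>d\<in>I. S i d * S i d) = (\<Sum>d\<in>I - {i}. S i d * S i d)"
      by (simp add: sum.remove[OF fin that] skew_facts(2)[OF that])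
    also have "\<dots> = (\<Sum>d\<in>I - {i}. 1)"
      using skew_facts(4)[OF that] by (intro sum.cong) fastforce+
    finally show ?thesis
      using card_Suc_Diff1[OF fin that] by simp
  qed
  have sq: "S a b * S a b = 1" "S a c * S a c = 1" "S b c * S b c = 1"
    using skew_facts(4)[of a b] skew_facts(4)[of a c] skew_facts(4)[of b c] abc mem by auto
  \<comment> \<open>In \<open>d\<close>, the Pfaffian is a signed combination of the rows
    \<open>a\<close>, \<open>b\<close>, \<open>c\<close>; the last three terms sum to multiples of
    their inner products, which vanish.\<close>
  have "(\<Sum>d\<in>I. (?v d)\<^sup>2) = (\<Sum>d\<in>I. (S a b * S a b) * (S c d * S c d) + (S a c * S a c) * (S b d * S b d)
      + (S b c * S b c) * (S a d * S a d) - 2 * S a b * S a c * (S b d * S c d)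
      + 2 * S a b * S b c * (S a d * S c d) - 2 * S a c * S b c * (S a d * S b d))"
    by (simp add: pfaffian4_def power2_eq_square algebra_simps)
  also have "\<dots> = 3 * (int (card I) - 1)"
    using abc mem norm skew_facts(5)[of b c] skew_facts(5)[of a c] skew_facts(5)[of a b]
    by (simp add: sum.distrib sum_subtractf sq flip: sum_distrib_left)
  finally have total: "(\<Sum>d\<in>I. (?v d)\<^sup>2) = 3 * (int (card I) - 1)" .
  \<comment> \<open>With a repeated index one term vanishes and the other two cancel by
    skewness.\<close>
  have "?v d = 0" if "d \<in> T" for d
    using that abc mem skew_facts(3)[of a b] skew_facts(3)[of a c] skew_facts(3)[of b c]
    by (auto simp: pfaffian4_def skew_facts(2) algebra_simps)
  then have "(\<Sum>d\<in>I. (?v d)\<^sup>2) = (\<Sum>d\<in>I - T. (?v d)\<^sup>2)"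
    using fin by (intro sum.mono_neutral_right) auto
  also have "\<dots> = (\<Sum>d\<in>I - T. 1 + (if d \<in> ?C then 8 else 0))"
  proof (intro sum.cong refl)
    fix d assume d: "d \<in> I - T"
    then have "d \<in> I" "a \<noteq> d" "b \<noteq> d" "c \<noteq> d"
      using abc(1) by auto
    then have "S a b = 1 \<or> S a b = -1" "S a c = 1 \<or> S a c = -1" "S a d = 1 \<or> S a d = -1"
      "S b c = 1 \<or> S b c = -1" "S b d = 1 \<or> S b d = -1" "S c d = 1 \<or> S c d = -1"
      using abc(2-4) mem by (simp_all add: skew_facts(4))
    \<comment> \<open>A sum of three signs is \<plusminus>1 or \<plusminus>3, and 9 = 1 + 8.\<close>
    then have "(?v d)\<^sup>2 = 1 + (if \<bar>?v d\<bar> = 3 then 8 else 0)"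
      by (elim disjE; simp add: pfaffian4_def)
    then show "(?v d)\<^sup>2 = 1 + (if d \<in> ?C then 8 else 0)"
      using d by (simp add: C)
  qed
  also have "\<dots> = int (card (I - T)) + 8 * int (card ?C)"
    using fin by (simp add: sum.distrib C flip: sum.inter_filter)
  finally have "3 * (int (card I) - 1) = int (card (I - T)) + 8 * int (card ?C)"
    unfolding total .
  \<comment> \<open>With n the order and c the codegree, this reads 3 (n - 1) = (n - 3) + 8 c, so 4
    c = n.\<close>
  with cardI show ?thesis
    by simp
qed

text \<open>All codegrees equal a quarter of the order; summing over triples counts each edge four
  times and gives equality in \<open>card_hyperedges_le\<close>.\<close>

lemma card_pfaffian_edges: "16 * card (pfaffian_edges I S) = card I * (card I choose 3)"
proof -
  have "16 * card (pfaffian_edges I S)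
      = 4 * (\<Sum>T\<in>triples I. card (codegree_set I (pfaffian_edges I S) T))"
    using sum_codegree[OF skew_facts(1) pfaffian_edges_subset] by simp
  also have "\<dots> = (\<Sum>T\<in>triples I. card I)"
    by (simp add: sum_distrib_left card_codegree_pfaffian_edges)
  finally show ?thesis
    by (simp add: card_triples[OF skew_facts(1)])
qed

end

section \<open>From a skew conference matrix to the extremal number\<close>

text \<open>Needed because \<open>ex_number\<close> ranges over hypergraphs on natural numbers,
  while the Paley matrix is indexed by field elements and a point at infinity.\<close>

lemma skew_conference_bij_betw:
  assumes "skew_conference I S" "bij_betw f J I"
  shows "skew_conference J (\<lambda>i j. S (f i) (f j))"
proof -
  have sum: "(\<Sum>k\<in>J. S i (f k) * S j (f k)) = (\<Sum>k\<in>I. S i k * S j k)" for i j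
    using sum.reindex_bij_betw[OF assms(2), of "\<lambda>k. S i k * S j k"] .
  have mem: "f i \<in> I" if "i \<in> J" for i
    using that assms(2) by (auto simp: bij_betw_def)
  have neq: "f i \<noteq> f j" if "i \<in> J" "j \<in> J" "i \<noteq> j" for i j
    using that assms(2) by (auto simp: bij_betw_def inj_on_def)
  have "finite J"
    using assms bij_betw_finite unfolding skew_conference_def by blast
  then show ?thesis
    unfolding skew_conference_def sum
  proof (intro conjI ballI impI)
    fix i j assume ij: "i \<in> J" "j \<in> J"
    show "S (f j) (f i) = - S (f i) (f j)"
      using ij by (intro skew_facts(3)[OF assms(1)] mem)
    assume "i \<noteq> j"
    then have f: "f i \<in> I" "f j \<in> I" "f i \<noteq> f j"
      using ij mem neq by blast+
    show "\<bar>S (f i) (f j)\<bar> = 1"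
      using skew_facts(4)[OF assms(1) f] by (elim disjE) simp_all
    show "(\<Sum>k\<in>I. S (f i) k * S (f j) k) = 0"
      by (rule skew_facts(5)[OF assms(1) f])
  qed (auto intro: skew_facts(2)[OF assms(1)] mem)
qed

lemma ex_number_F53:
  assumes "skew_conference I S"
  shows "16 * ex_number 4 (card I) F53 = card I * (card I choose 3)"
proof -
  let ?n = "card I"
  have "finite I"
    using assms by (simp add: skew_conference_def)
  then obtain f where "bij_betw f {..<?n} I"
    using ex_bij_betw_nat_finite[of I] by (auto simp: atLeast0LessThan)
  then have S': "skew_conference {..<?n} (\<lambda>i j. S (f i) (f j))"
    using assms by (rule skew_conference_bij_betw[rotated])
  define E where "E = pfaffian_edges {..<?n} (\<lambda>i j. S (f i) (f j))"
  have E: "16 * card E = ?n * (?n choose 3)"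
    using card_pfaffian_edges[OF S'] by (simp add: E_def)
  have "uniform_hypergraph 4 ({..<?n}, E)"
    using pfaffian_edges_subset[OF S']
    by (auto simp: uniform_hypergraph_def verts_def hyperedges_def E_def)
  with pfaffian_edges_F53_free[OF S']
  have "card E \<in> ex_sizes 4 ?n F53"
    unfolding ex_sizes_def mem_Collect_eq
    by (intro exI[of _ "({..<?n}, E)"]) (simp add: verts_def hyperedges_def E_def)
  moreover have "m \<le> card E" if "m \<in> ex_sizes 4 ?n F53" for m
  proof -
    have "16 * m \<le> ?n * (?n choose 3)"
      using that card_hyperedges_le unfolding ex_sizes_def by fastforce
    with E show ?thesis
      by linarith
  qed
  ultimately have "ex_number 4 ?n F53 = card E"
    unfolding ex_number_def by (intro Max_eqI finite_ex_sizes)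
  with E show ?thesis
    by simp
qed

section \<open>Congruences modulo an ideal\<close>

text \<open>Ring and ideal are subsets of one ambient type, so a ring of complex numbers can be used
  directly, with congruence in place of a quotient. \<open>M = A\<close> is allowed; properness is
  assumed separately.\<close>

locale subring_ideal =
  fixes A M :: "'a::comm_ring_1 set"
  assumes one_A: "1 \<in> A"
    and diff_A: "x \<in> A \<Longrightarrow> y \<in> A \<Longrightarrow> x - y \<in> A"
    and mult_A: "x \<in> A \<Longrightarrow> y \<in> A \<Longrightarrow> x * y \<in> A"
    and M_subset: "M \<subseteq> A"
    and zero_M: "0 \<in> M"
    and diff_M: "x \<in> M \<Longrightarrow> y \<in> M \<Longrightarrow> x - y \<in> M"
    and mult_M: "a \<in> A \<Longrightarrow> x \<in> M \<Longrightarrow> a * x \<in> M"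
begin

definition mcong :: "'a \<Rightarrow> 'a \<Rightarrow> bool"  (infix \<open>\<approx>\<close> 50) where
  "x \<approx> y \<longleftrightarrow> x - y \<in> M"

lemma zero_A: "0 \<in> A"
  using M_subset zero_M by blast

lemma minus_A: "x \<in> A \<Longrightarrow> - x \<in> A"
  using diff_A[OF zero_A] by simp

lemma add_A: "x \<in> A \<Longrightarrow> y \<in> A \<Longrightarrow> x + y \<in> A"
  using diff_A[of x "- y"] minus_A by simp

lemma power_A: "x \<in> A \<Longrightarrow> x ^ n \<in> A"
  by (induction n) (simp_all add: one_A mult_A)

lemma of_nat_A: "of_nat n \<in> A"
  by (induction n) (simp_all add: zero_A one_A add_A)

lemma minus_M: "x \<in> M \<Longrightarrow> - x \<in> M"
  using diff_M[OF zero_M] by simp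

lemma add_M: "x \<in> M \<Longrightarrow> y \<in> M \<Longrightarrow> x + y \<in> M"
  using diff_M[of x "- y"] minus_M by simp

lemma sum_M: "(\<And>i. i \<in> I \<Longrightarrow> f i \<in> M) \<Longrightarrow> sum f I \<in> M"
  by (induction I rule: infinite_finite_induct) (simp_all add: zero_M add_M)

lemma mcong_0_iff: "x \<approx> 0 \<longleftrightarrow> x \<in> M"
  by (simp add: mcong_def)

lemma mcong_refl [simp]: "x \<approx> x"
  by (simp add: mcong_def zero_M)

lemma mcong_sym: "x \<approx> y \<Longrightarrow> y \<approx> x"
  using minus_M[of "x - y"] by (simp add: mcong_def)

lemma mcong_trans [trans]: "x \<approx> y \<Longrightarrow> y \<approx> z \<Longrightarrow> x \<approx> z"
  using add_M[of "x - y" "y - z"] by (simp add: mcong_def)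

lemma mcong_diff: "x \<approx> y \<Longrightarrow> x' \<approx> y' \<Longrightarrow> x - x' \<approx> y - y'"
  using diff_M[of "x - y" "x' - y'"] by (simp add: mcong_def algebra_simps)

text \<open>From x x' - y y' = x (x' - y') + y' (x - y): the multipliers \<open>x\<close> and
  \<open>y'\<close> have to lie in \<open>A\<close>.\<close>

lemma mcong_mult:
  assumes "x \<approx> y" "x' \<approx> y'" "x \<in> A" "y' \<in> A"
  shows "x * x' \<approx> y * y'"
  using add_M[OF mult_M[of x "x' - y'"] mult_M[of y' "x - y"]] assms
  by (simp add: mcong_def algebra_simps)

lemma mcong_power: "x \<approx> y \<Longrightarrow> x \<in> A \<Longrightarrow> y \<in> A \<Longrightarrow> x ^ n \<approx> y ^ n"
  by (induction n) (simp_all add: mcong_mult power_A)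

end

section \<open>The Paley matrix of a residue field\<close>

text \<open>\<open>K\<close> is a system of representatives of the residue field \<open>A / M\<close>.\<close>

locale residue_field = subring_ideal A M for A M :: "'a::comm_ring_1 set" +
  fixes K :: "'a set"
  assumes one_notin_M: "1 \<notin> M"
    and two_notin_M: "2 \<notin> M"
    and prime_M: "x \<in> A \<Longrightarrow> y \<in> A \<Longrightarrow> x * y \<in> M \<Longrightarrow> x \<in> M \<or> y \<in> M"
    and finite_K: "finite K"
    and K_subset: "K \<subseteq> A"
    and ex_K: "x \<in> A \<Longrightarrow> \<exists>k\<in>K. x - k \<in> M"
    and inj_K: "x \<in> K \<Longrightarrow> y \<in> K \<Longrightarrow> x - y \<in> M \<Longrightarrow> x = y"
    and fermat: "x \<in> A \<Longrightarrow> x ^ card K - x \<in> M"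
    and card_K_mod_4: "card K mod 4 = 3"
begin

section \<open>The quadratic character of the residue field\<close>

definition half :: nat where
  "half = card K div 2"

lemma card_K_eq: "card K = 2 * half + 1" and odd_half: "odd half"
  using card_K_mod_4 unfolding half_def by presburger+

text \<open>Euler's criterion serves as the definition, which reduces multiplicativity and the
  behaviour under negation to laws of powers.\<close>

definition quad_char :: "'a \<Rightarrow> int" where
  "quad_char x = (if x \<in> M then 0 else if x ^ half \<approx> 1 then 1 else -1)"

lemma quad_char_cases: "quad_char x = 0 \<or> quad_char x = 1 \<or> quad_char x = -1"
  by (simp add: quad_char_def)

lemma quad_char_eq_0_iff: "quad_char x = 0 \<longleftrightarrow> x \<in> M"
  by (simp add: quad_char_def)

text \<open>The product \<open>x * ((x ^ half - 1) * (x ^ half + 1)) = x ^ card K - x\<close> lies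
  in the prime ideal \<open>M\<close>, so one of its factors does.\<close>

lemma quad_char_mcong:
  assumes "x \<in> A"
  shows "of_int (quad_char x) \<approx> x ^ half"
proof -
  have "half > 0"
    using odd_half by (cases half) auto
  have *: "x ^ half \<in> M" if "x \<in> M"
    using mult_M[OF power_A[OF assms] that, of "half - 1"]
    unfolding power_minus_mult[OF \<open>half > 0\<close>] .
  have "x * ((x ^ half - 1) * (x ^ half + 1)) = x ^ card K - x"
    by (simp add: card_K_eq algebra_simps power_mult power2_eq_square)
  then have "x * ((x ^ half - 1) * (x ^ half + 1)) \<in> M"
    using fermat[OF assms] by simp
  moreover have "x ^ half - 1 \<in> A" "x ^ half + 1 \<in> A"
    using assms by (simp_all add: diff_A add_A power_A one_A)
  ultimately have "x \<in> M \<or> x ^ half - 1 \<in> M \<or> x ^ half + 1 \<in> M"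
    using prime_M[of x] prime_M[of "x ^ half - 1"] assms mult_A by blast
  moreover have "-1 \<approx> x ^ half" if "x ^ half + 1 \<in> M"
    by (rule mcong_sym) (use that in \<open>simp add: mcong_def\<close>)
  ultimately show ?thesis
    using * mcong_sym[of "x ^ half" 0] mcong_sym[of "x ^ half" 1]
    by (auto simp: quad_char_def mcong_0_iff) (simp add: mcong_def)
qed

text \<open>As neither 1 nor 2 lies in \<open>M\<close>, the values 0, 1, -1 are pairwise
  incongruent. Identities for \<open>quad_char\<close> can therefore be proved modulo
  \<open>M\<close>.\<close>

lemma sign_mcong_eq:
  assumes "s = 0 \<or> s = 1 \<or> s = (-1::int)" "t = 0 \<or> t = 1 \<or> t = -1" "of_int s \<approx> (of_int t :: 'a)"
  shows "s = t"
  using assms one_notin_M two_notin_M minus_M[of "-1"] minus_M[of "-2"]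
  by (auto simp: mcong_def)

lemma quad_char_eqI:
  assumes "x \<in> A" "s = 0 \<or> s = 1 \<or> s = -1" "of_int s \<approx> x ^ half"
  shows "quad_char x = s"
  using quad_char_cases assms(2)
proof (rule sign_mcong_eq)
  show "of_int (quad_char x) \<approx> (of_int s :: 'a)"
    using quad_char_mcong[OF assms(1)] mcong_sym[OF assms(3)] by (rule mcong_trans)
qed

lemma quad_char_cong:
  assumes "x \<in> A" "y \<in> A" "x \<approx> y"
  shows "quad_char x = quad_char y"
proof (rule quad_char_eqI[OF assms(1) quad_char_cases])
  have "of_int (quad_char y) \<approx> y ^ half"
    using assms(2) by (rule quad_char_mcong)
  also have "\<dots> \<approx> x ^ half"
    by (rule mcong_power[OF mcong_sym[OF assms(3)] assms(2,1)])
  finally show "of_int (quad_char y) \<approx> x ^ half" .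
qed

lemma of_int_sign_A: "s = 0 \<or> s = 1 \<or> s = (-1::int) \<Longrightarrow> of_int s \<in> A"
  using zero_A one_A minus_A by auto

lemma quad_char_mult:
  assumes "x \<in> A" "y \<in> A"
  shows "quad_char (x * y) = quad_char x * quad_char y"
proof (rule quad_char_eqI)
  show "x * y \<in> A"
    using assms by (rule mult_A)
  show "quad_char x * quad_char y = 0 \<or> quad_char x * quad_char y = 1 \<or> quad_char x * quad_char y = -1"
    using quad_char_cases[of x] quad_char_cases[of y] by auto
  have "of_int (quad_char x) * of_int (quad_char y) \<approx> x ^ half * y ^ half"
    using assms quad_char_cases by (intro mcong_mult quad_char_mcong of_int_sign_A power_A)
  then show "of_int (quad_char x * quad_char y) \<approx> (x * y) ^ half"
    by (simp add: power_mult_distrib)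
qed

lemma quad_char_1: "quad_char 1 = 1"
  by (simp add: quad_char_def one_notin_M)

lemma quad_char_power: "x \<in> A \<Longrightarrow> quad_char (x ^ n) = quad_char x ^ n"
  by (induction n) (simp_all add: quad_char_1 quad_char_mult power_A)

text \<open>Because \<open>half\<close> is odd, -1 is a non-residue; this makes the Paley matrix
  skew.\<close>

lemma quad_char_minus:
  assumes "x \<in> A"
  shows "quad_char (- x) = - quad_char x"
proof (rule quad_char_eqI)
  have "0 - of_int (quad_char x) \<approx> 0 - x ^ half"
    using assms by (intro mcong_diff quad_char_mcong mcong_refl)
  then show "of_int (- quad_char x) \<approx> (- x) ^ half"
    using odd_half by simp
qed (use assms minus_A quad_char_cases[of x] in auto)

section \<open>Representatives and character sums\<close>

definition rep :: "'a \<Rightarrow> 'a" where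
  "rep x = (SOME k. k \<in> K \<and> x \<approx> k)"

lemma rep: "x \<in> A \<Longrightarrow> rep x \<in> K \<and> x \<approx> rep x"
  unfolding rep_def by (rule someI_ex) (unfold mcong_def, use ex_K in blast)

lemma mem_A_if_mem_K: "x \<in> K \<Longrightarrow> x \<in> A"
  using K_subset by blast

lemma K_mcong_eq: "x \<in> K \<Longrightarrow> y \<in> K \<Longrightarrow> x \<approx> y \<Longrightarrow> x = y"
  using inj_K by (simp add: mcong_def)

lemma rep_eq_iff:
  assumes "x \<in> A" "y \<in> A"
  shows "rep x = rep y \<longleftrightarrow> x \<approx> y"
proof
  assume "rep x = rep y"
  then have "x \<approx> rep y" "rep y \<approx> y"
    using rep[OF assms(1)] rep[OF assms(2)] mcong_sym by auto
  then show "x \<approx> y"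
    by (rule mcong_trans)
next
  assume "x \<approx> y"
  have "rep x \<approx> x"
    using rep[OF assms(1)] mcong_sym by simp
  also note \<open>x \<approx> y\<close>
  also have "y \<approx> rep y"
    using rep[OF assms(2)] by simp
  finally show "rep x = rep y"
    using rep assms by (intro K_mcong_eq) auto
qed

text \<open>A change of variables in the residue field: \<open>rep\<close> returns the values of
  \<open>g\<close> to representatives, and injectivity between finite sets of equal size gives a
  bijection.\<close>

lemma sum_quad_char_reindex:
  assumes "L \<subseteq> K" "L' \<subseteq> K" "card L = card L'"
    and g: "\<And>x. x \<in> L \<Longrightarrow> g x \<in> A"
    and mem: "\<And>x. x \<in> L \<Longrightarrow> rep (g x) \<in> L'"
    and inj: "\<And>x y. x \<in> L \<Longrightarrow> y \<in> L \<Longrightarrow> g x \<approx> g y \<Longrightarrow> x \<approx> y"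
  shows "(\<Sum>x\<in>L. quad_char (g x)) = (\<Sum>x\<in>L'. quad_char x)"
proof -
  have "inj_on (\<lambda>x. rep (g x)) L"
  proof (rule inj_onI)
    fix x y assume "x \<in> L" "y \<in> L" "rep (g x) = rep (g y)"
    then have "x \<approx> y"
      using g inj rep_eq_iff by blast
    with \<open>x \<in> L\<close> \<open>y \<in> L\<close> show "x = y"
      using assms(1) by (intro K_mcong_eq) auto
  qed
  moreover from this have "(\<lambda>x. rep (g x)) ` L = L'"
    using mem assms(3) by (intro card_subset_eq finite_subset[OF assms(2) finite_K]) (auto simp: card_image)
  ultimately have "bij_betw (\<lambda>x. rep (g x)) L L'"
    by (simp add: bij_betw_def)
  then have "(\<Sum>x\<in>L'. quad_char x) = (\<Sum>x\<in>L. quad_char (rep (g x)))"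
    by (rule sum.reindex_bij_betw[symmetric])
  also have "\<dots> = (\<Sum>x\<in>L. quad_char (g x))"
  proof (intro sum.cong refl quad_char_cong)
    fix x assume "x \<in> L"
    then show "rep (g x) \<in> A" "g x \<in> A" "rep (g x) \<approx> g x"
      using g rep[of "g x"] mem_A_if_mem_K mcong_sym by auto
  qed
  finally show ?thesis ..
qed

text \<open>The substitution of - x for x turns the sum into its negative.\<close>

lemma sum_quad_char: "(\<Sum>x\<in>K. quad_char x) = 0"
proof -
  have "(\<Sum>x\<in>K. quad_char (- x)) = (\<Sum>x\<in>K. quad_char x)"
  proof (rule sum_quad_char_reindex)
    show "x \<approx> y" if "- x \<approx> - y" for x y
      using mcong_diff[OF mcong_refl[of 0] that] by simp
  qed (use minus_A mem_A_if_mem_K rep in auto)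
  moreover have "(\<Sum>x\<in>K. quad_char (- x)) = - (\<Sum>x\<in>K. quad_char x)"
    by (simp add: quad_char_minus mem_A_if_mem_K flip: sum_negf)
  ultimately show ?thesis
    by simp
qed

lemma sum_quad_char_shift:
  assumes "a \<in> A"
  shows "(\<Sum>x\<in>K. quad_char (x - a)) = 0"
proof -
  have "(\<Sum>x\<in>K. quad_char (x - a)) = (\<Sum>x\<in>K. quad_char x)"
    by (rule sum_quad_char_reindex)
      (use assms diff_A mem_A_if_mem_K rep in \<open>auto simp: mcong_def\<close>)
  then show ?thesis
    by (simp add: sum_quad_char)
qed

lemma mult_cancel_mcong:
  assumes "c \<in> A" "c \<notin> M" "x \<in> A" "y \<in> A" "x * c \<approx> y * c"
  shows "x \<approx> y"
  using prime_M[of "x - y" c] assms diff_A by (simp add: mcong_def left_diff_distrib)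

text \<open>Cancelling \<open>x\<close> in the Fermat congruence provides an inverse inside
  \<open>A\<close>, where division need not be possible.\<close>

lemma power_inverse_mcong:
  assumes "x \<in> A" "x \<notin> M"
  shows "x ^ (card K - 2) * x \<approx> 1"
proof -
  have "card K \<ge> 2"
    using card_K_mod_4 by presburger
  then have "card K = Suc (Suc (card K - 2))"
    by simp
  then have "(x ^ (card K - 2) * x) * x = x ^ card K"
    by (metis mult.assoc power_Suc2)
  then have "(x ^ (card K - 2) * x) * x \<approx> 1 * x"
    using fermat[OF assms(1)] by (simp add: mcong_def)
  then show ?thesis
    using assms mult_A power_A one_A by (blast intro: mult_cancel_mcong)
qed

text \<open>For \<open>x \<noteq> a\<close> the summand is the character of \<open>(x - b) / (x - a)\<close>, which takes every value
  of the residue field except \<open>1\<close>.\<close>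

lemma sum_quad_char_mult:
  assumes "a \<in> K" "b \<in> K" "a \<noteq> b"
  shows "(\<Sum>x\<in>K. quad_char (x - a) * quad_char (x - b)) = -1"
proof -
  \<comment> \<open>The quotient (x - b) / (x - a), with the inverse written as a power.\<close>
  define g where "g x = (x - b) * (x - a) ^ (card K - 2)" for x
  have A: "x - a \<in> A" "x - b \<in> A" "g x \<in> A" if "x \<in> K" for x
    using mem_A_if_mem_K[OF that] mem_A_if_mem_K[OF assms(1)] mem_A_if_mem_K[OF assms(2)]
    by (simp_all add: g_def diff_A mult_A power_A)
  have notin: "x - a \<notin> M" if "x \<in> K - {a}" for x
    using that assms(1) inj_K by blast
  have ba: "b - a \<in> A" "b - a \<notin> M"
    using A notin assms by auto
  have g_mult: "g x * (x - a) \<approx> x - b" if "x \<in> K - {a}" for x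
  proof -
    have "(x - b) * ((x - a) ^ (card K - 2) * (x - a)) \<approx> (x - b) * 1"
      using that A notin one_A by (intro mcong_mult power_inverse_mcong) auto
    then show ?thesis
      by (simp add: g_def mult.assoc)
  qed
  have not1: "\<not> g x \<approx> 1" if x: "x \<in> K - {a}" for x
  proof
    assume "g x \<approx> 1"
    then have "g x * (x - a) \<approx> 1 * (x - a)"
      using A x by (intro mcong_mult) auto
    with mcong_sym[OF g_mult[OF x]] have "x - b \<approx> x - a"
      by (simp add: mcong_trans)
    then have "- (b - a) \<in> M"
      by (simp add: mcong_def)
    then show False
      using ba(2) minus_M by fastforce
  qed
  have inj: "x \<approx> y" if xy: "x \<in> K - {a}" "y \<in> K - {a}" and eq: "g x \<approx> g y" for x y
  proof -
    have "(x - b) * (y - a) \<approx> (g x * (x - a)) * (y - a)"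
      using xy A g_mult mcong_sym by (intro mcong_mult) auto
    also have "\<dots> = g x * ((x - a) * (y - a))"
      by (rule mult.assoc)
    also have "\<dots> \<approx> g y * ((x - a) * (y - a))"
      using xy A eq mult_A by (intro mcong_mult) auto
    also have "\<dots> = (g y * (y - a)) * (x - a)"
      by (simp add: mult_ac)
    also have "\<dots> \<approx> (y - b) * (x - a)"
      using xy A g_mult mult_A by (intro mcong_mult) auto
    finally have "(x - b) * (y - a) \<approx> (y - b) * (x - a)" .
    \<comment> \<open>The cross-multiplied sides differ by (x - y) (b - a), and b - a is
      cancellable.\<close>
    moreover have "x * (b - a) - y * (b - a) = (x - b) * (y - a) - (y - b) * (x - a)"
      by (simp add: algebra_simps)
    ultimately have "x * (b - a) \<approx> y * (b - a)"
      by (simp add: mcong_def)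
    then show ?thesis
      using ba xy mem_A_if_mem_K by (blast intro: mult_cancel_mcong)
  qed
  \<comment> \<open>An odd power fixes 0, 1 and -1, so the inverse of an element has the same
    character as the element.\<close>
  have "odd (card K - 2)"
    using card_K_mod_4 by presburger
  then obtain m where m: "card K - 2 = 2 * m + 1"
    by (elim oddE)
  have "quad_char (g x) = quad_char (x - a) * quad_char (x - b)" if "x \<in> K - {a}" for x
  proof -
    have "quad_char (x - a) ^ (card K - 2) = quad_char (x - a)"
      using quad_char_cases[of "x - a"] unfolding m by (elim disjE) simp_all
    then show ?thesis
      using that A by (simp add: g_def quad_char_mult quad_char_power power_A)
  qed
  then have "(\<Sum>x\<in>K - {a}. quad_char (x - a) * quad_char (x - b)) = (\<Sum>x\<in>K - {a}. quad_char (g x))"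
    by simp
  also have "\<dots> = (\<Sum>x\<in>K - {rep 1}. quad_char x)"
  proof (rule sum_quad_char_reindex)
    show "card (K - {a}) = card (K - {rep 1})"
      using assms(1) rep one_A finite_K by (simp add: card_Diff_singleton)
    show "rep (g x) \<in> K - {rep 1}" if "x \<in> K - {a}" for x
      using not1[OF that] rep[of "g x"] rep_eq_iff[of "g x" 1] A(3)[of x] one_A that by simp
  qed (use A inj in auto)
  also have "\<dots> = (\<Sum>x\<in>K. quad_char x) - quad_char (rep 1)"
    using rep[OF one_A] finite_K by (simp add: sum_diff1)
  also have "quad_char (rep 1) = quad_char 1"
    using rep[OF one_A] one_A mem_A_if_mem_K mcong_sym by (intro quad_char_cong) auto
  finally show ?thesis
    using assms(1) finite_K quad_char_eq_0_iff[of 0] zero_M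
    by (simp add: sum.remove[of K a] sum_quad_char quad_char_1)
qed

section \<open>The bordered Paley matrix\<close>

text \<open>\<open>None\<close> is the point at infinity; the border row and column have opposite
  signs to match the skewness of \<open>quad_char (y - x)\<close>.\<close>

fun paley :: "'a option \<Rightarrow> 'a option \<Rightarrow> int" where
  "paley None None = 0"
| "paley None (Some y) = 1"
| "paley (Some x) None = -1"
| "paley (Some x) (Some y) = quad_char (y - x)"

lemma skew_conference_paley: "skew_conference (insert None (Some ` K)) paley"
proof -
  have sum: "(\<Sum>k\<in>insert None (Some ` K). f k) = f None + (\<Sum>k\<in>K. f (Some k))"
    for f :: "'a option \<Rightarrow> int"
    using finite_K by (simp add: sum.reindex)
  have skew: "quad_char (x - y) = - quad_char (y - x)" if "x \<in> K" "y \<in> K" for x y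
    using quad_char_minus[of "y - x"] that diff_A mem_A_if_mem_K by simp
  have sign: "\<bar>quad_char (y - x)\<bar> = 1" if "x \<in> K" "y \<in> K" "x \<noteq> y" for x y
    using that inj_K quad_char_cases[of "y - x"] quad_char_eq_0_iff[of "y - x"] by auto
  show ?thesis
    unfolding skew_conference_def sum
  proof (intro conjI ballI impI)
    fix i j assume ij: "i \<in> insert None (Some ` K)" "j \<in> insert None (Some ` K)"
    show "paley j i = - paley i j"
      using ij by (cases i; cases j) (auto intro: skew)
    assume "i \<noteq> j"
    show "\<bar>paley i j\<bar> = 1"
      using ij \<open>i \<noteq> j\<close> sign by (cases i; cases j) auto
    \<comment> \<open>For two field rows the border contributes 1 and the character sum -1; for the
      border row and a field row both terms vanish.\<close>
    show "paley i None * paley j None + (\<Sum>k\<in>K. paley i (Some k) * paley j (Some k)) = 0"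
      using ij \<open>i \<noteq> j\<close> sum_quad_char_shift sum_quad_char_mult mem_A_if_mem_K
      by (cases i; cases j) auto
  next
    fix i assume "i \<in> insert None (Some ` K)"
    show "paley i i = 0"
      using quad_char_eq_0_iff[of 0] zero_M by (cases i) auto
  qed (simp add: finite_K)
qed

lemma ex_number_F53_card_K:
  "16 * ex_number 4 (card K + 1) F53 = (card K + 1) * ((card K + 1) choose 3)"
proof -
  have "card (insert None (Some ` K)) = card K + 1"
    using finite_K by (simp add: card_image)
  then show ?thesis
    using ex_number_F53[OF skew_conference_paley] by simp
qed

end

section \<open>Finite fields as residue fields of cyclotomic rings\<close>

text \<open>A Nakayama-type statement, proved by eliminating one generator at a time.\<close>

lemma divisible_span_imp_zero:
  fixes v :: "'b \<Rightarrow> 'a::{idom, ring_char_0}" and p :: int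
  assumes "finite I" "prime p"
    and "\<And>i. i \<in> I \<Longrightarrow> \<exists>m a. \<not> p dvd m \<and> of_int m * v i = of_int p * (\<Sum>j\<in>I. of_int (a j) * v j)"
  shows "\<forall>i\<in>I. v i = 0"
  using assms(1,3)
proof (induction I rule: finite_induct)
  case (insert n I)
  obtain m a where m: "\<not> p dvd m" "of_int m * v n = of_int p * (\<Sum>j\<in>insert n I. of_int (a j) * v j)"
    using insert.prems[of n] by blast
  \<comment> \<open>The \<open>v n\<close> term on the right moves to the left; subtracting a
    multiple of \<open>p\<close> keeps the coefficient prime to \<open>p\<close>.\<close>
  define m' where "m' = m - p * a n"
  have m': "\<not> p dvd m'"
    using m(1) unfolding m'_def by (metis diff_add_cancel dvd_add dvd_triv_left)
  have vn: "of_int m' * v n = of_int p * (\<Sum>j\<in>I. of_int (a j) * v j)"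
    using m(2) insert.hyps by (simp add: m'_def algebra_simps)
  have "\<forall>i\<in>I. v i = 0"
  proof (rule insert.IH)
    fix i assume "i \<in> I"
    then obtain k b where k: "\<not> p dvd k"
      "of_int k * v i = of_int p * (\<Sum>j\<in>insert n I. of_int (b j) * v j)"
      using insert.prems[of i] by blast
    \<comment> \<open>Multiplying by \<open>m'\<close> allows \<open>vn\<close> to eliminate
      \<open>v n\<close> without division.\<close>
    have "of_int (m' * k) * v i = of_int m' * (of_int k * v i)"
      by (simp add: mult_ac)
    also have "\<dots> = of_int p * (of_int (b n) * (of_int m' * v n)
        + of_int m' * (\<Sum>j\<in>I. of_int (b j) * v j))"
      using k(2) insert.hyps by (simp add: algebra_simps)
    also have "\<dots> = of_int p * (\<Sum>j\<in>I. of_int (b n * p * a j + m' * b j) * v j)"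
      unfolding vn by (simp add: algebra_simps sum.distrib sum_distrib_left)
    finally have "of_int (m' * k) * v i
        = of_int p * (\<Sum>j\<in>I. of_int (b n * p * a j + m' * b j) * v j)" .
    moreover have "\<not> p dvd m' * k"
      using m' k(1) \<open>prime p\<close> by (simp add: prime_dvd_mult_iff)
    ultimately show "\<exists>m a. \<not> p dvd m \<and> of_int m * v i = of_int p * (\<Sum>j\<in>I. of_int (a j) * v j)"
      by (intro exI[of _ "m' * k"] exI[of _ "\<lambda>j. b n * p * a j + m' * b j"]) simp
  qed
  moreover from this have "v n = 0"
    using vn m' by auto
  ultimately show ?case
    by simp
qed simp

section \<open>Prime ideals and the Frobenius map\<close>

context subring_ideal
begin

text \<open>Zorn gives an ideal P maximal among those containing \<open>M\<close> but not 1. If x is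
  outside P, then 1 = m + a x with m in P, and multiplying by y puts y in P whenever x y is in
  P.\<close>

lemma ex_prime_ideal:
  assumes "1 \<notin> M"
  obtains P where "subring_ideal A P" "M \<subseteq> P" "1 \<notin> P"
    "\<And>x y. x \<in> A \<Longrightarrow> y \<in> A \<Longrightarrow> x * y \<in> P \<Longrightarrow> x \<in> P \<or> y \<in> P"
proof -
  define \<A> where "\<A> = {P. subring_ideal A P \<and> M \<subseteq> P \<and> 1 \<notin> P}"
  have ideals: "subring_ideal A P \<longleftrightarrow> P \<subseteq> A \<and> 0 \<in> P \<and> (\<forall>x\<in>P. \<forall>y\<in>P. x - y \<in> P) \<and> (\<forall>a\<in>A. \<forall>x\<in>P. a * x \<in> P)"
    for P
    using one_A diff_A mult_A unfolding subring_ideal_def by blast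
  have "\<exists>P\<in>\<A>. \<forall>X\<in>\<A>. P \<subseteq> X \<longrightarrow> X = P"
  proof (rule subset_Zorn_nonempty)
    have "M \<in> \<A>"
      using assms subring_ideal_axioms by (simp add: \<A>_def)
    then show "\<A> \<noteq> {}"
      by blast
    fix \<C> assume ne: "\<C> \<noteq> {}" and ch: "subset.chain \<A> \<C>"
    have sub: "\<C> \<subseteq> \<A>" and tot: "\<And>X Y. X \<in> \<C> \<Longrightarrow> Y \<in> \<C> \<Longrightarrow> X \<subseteq> Y \<or> Y \<subseteq> X"
      using ch unfolding subset.chain_def by blast+
    have id: "X \<subseteq> A" "0 \<in> X" "\<And>x y. x \<in> X \<Longrightarrow> y \<in> X \<Longrightarrow> x - y \<in> X"
      "\<And>a x. a \<in> A \<Longrightarrow> x \<in> X \<Longrightarrow> a * x \<in> X" if "X \<in> \<C>" for X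
      using subsetD[OF sub that] by (simp_all add: \<A>_def ideals)
    have diff: "x - y \<in> \<Union>\<C>" if "x \<in> \<Union>\<C>" "y \<in> \<Union>\<C>" for x y
    proof -
      from that obtain X where "X \<in> \<C>" "x \<in> X" "y \<in> X"
        using tot by blast
      then show ?thesis
        using id(3) by blast
    qed
    have "subring_ideal A (\<Union>\<C>)"
      unfolding ideals
    proof (intro conjI ballI)
      show "0 \<in> \<Union>\<C>"
        using ne id(2) by blast
      show "\<Union>\<C> \<subseteq> A"
        using id(1) by blast
      show "x - y \<in> \<Union>\<C>" if "x \<in> \<Union>\<C>" "y \<in> \<Union>\<C>" for x y
        using that by (rule diff)
      show "a * x \<in> \<Union>\<C>" if "a \<in> A" "x \<in> \<Union>\<C>" for a x
        using that id(4) by blast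
    qed
    then show "\<Union>\<C> \<in> \<A>"
      using ne sub unfolding \<A>_def by blast
  qed
  then obtain P where P: "P \<in> \<A>" and max: "\<And>X. X \<in> \<A> \<Longrightarrow> P \<subseteq> X \<Longrightarrow> X = P"
    by blast
  interpret P: subring_ideal A P
    using P by (simp add: \<A>_def)
  have "x \<in> P \<or> y \<in> P" if xy: "x \<in> A" "y \<in> A" "x * y \<in> P" for x y
  proof (rule ccontr)
    assume not: "\<not> (x \<in> P \<or> y \<in> P)"
    define Q where "Q = {m + a * x | m a. m \<in> P \<and> a \<in> A}"
    have QI: "m + a * x \<in> Q" if "m \<in> P" "a \<in> A" for m a
      using that unfolding Q_def by blast
    have "P \<subseteq> Q"
      using QI[OF _ zero_A] by auto
    moreover have "x \<in> Q"
      using QI[OF P.zero_M one_A] by simp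
    moreover have "subring_ideal A Q"
      unfolding ideals
    proof (intro conjI ballI)
      show "Q \<subseteq> A"
        using xy(1) P.M_subset add_A mult_A unfolding Q_def by blast
      show "0 \<in> Q"
        using P.zero_M \<open>P \<subseteq> Q\<close> by blast
      fix u assume "u \<in> Q"
      then obtain m a where u: "u = m + a * x" "m \<in> P" "a \<in> A"
        unfolding Q_def by blast
      show "u - v \<in> Q" if vQ: "v \<in> Q" for v
      proof -
        obtain n b where v: "v = n + b * x" "n \<in> P" "b \<in> A"
          using vQ unfolding Q_def by blast
        have "u - v = (m - n) + (a - b) * x"
          by (simp add: u v algebra_simps)
        then show ?thesis
          using QI[OF P.diff_M[OF u(2) v(2)] diff_A[OF u(3) v(3)]] by simp
      qed
      show "c * u \<in> Q" if "c \<in> A" for c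
      proof -
        have "c * u = c * m + (c * a) * x"
          by (simp add: u algebra_simps)
        then show ?thesis
          using QI[OF P.mult_M[OF that u(2)] mult_A[OF that u(3)]] by simp
      qed
    qed
    ultimately have "1 \<in> Q"
      using max[of Q] P not unfolding \<A>_def by blast
    then obtain m a where "1 = m + a * x" "m \<in> P" "a \<in> A"
      unfolding Q_def by blast
    then have "y = y * m + a * (x * y)"
      by (metis mult.commute mult.left_commute distrib_left mult_1_right)
    moreover have "y * m + a * (x * y) \<in> P"
      using P.add_M[OF P.mult_M[OF xy(2) \<open>m \<in> P\<close>] P.mult_M[OF \<open>a \<in> A\<close> xy(3)]] .
    ultimately show False
      using not by metis
  qed
  with P show thesis
    by (intro that[of P]) (auto simp: \<A>_def)
qed

text \<open>The inner binomial coefficients are multiples of \<open>p\<close>, so only the two end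
  terms survive modulo \<open>M\<close>.\<close>

lemma frobenius_add:
  assumes "prime p" "of_nat p \<in> M" "x \<in> A" "y \<in> A"
  shows "(x + y) ^ p \<approx> x ^ p + y ^ p"
proof -
  let ?f = "\<lambda>k. of_nat (p choose k) * x ^ k * y ^ (p - k)"
  have p: "p > 0"
    using assms(1) by (rule prime_gt_0_nat)
  have "?f k \<in> M" if "k \<in> {0<..<p}" for k
  proof -
    have "p dvd (p choose k)"
      using that assms(1) by (intro dvd_choose_prime) auto
    then obtain c where "p choose k = c * p"
      by (metis dvdE mult.commute)
    then have "?f k = (of_nat c * x ^ k * y ^ (p - k)) * of_nat p"
      by (simp add: mult_ac)
    then show ?thesis
      using assms by (auto intro!: mult_M mult_A power_A of_nat_A)
  qed
  then have "(\<Sum>k\<in>{0<..<p}. ?f k) \<in> M"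
    by (rule sum_M)
  moreover have "{..p} = insert 0 (insert p {0<..<p})"
    using p by auto
  then have "(x + y) ^ p = x ^ p + y ^ p + (\<Sum>k\<in>{0<..<p}. ?f k)"
    using p by (simp add: binomial_ring)
  ultimately show ?thesis
    by (simp add: mcong_def)
qed

lemma frobenius_power_add:
  assumes "prime p" "of_nat p \<in> M" "x \<in> A" "y \<in> A"
  shows "(x + y) ^ (p ^ k) \<approx> x ^ (p ^ k) + y ^ (p ^ k)"
proof (induction k)
  case (Suc k)
  have "((x + y) ^ (p ^ k)) ^ p \<approx> (x ^ (p ^ k) + y ^ (p ^ k)) ^ p"
    using Suc assms by (intro mcong_power power_A add_A)
  also have "\<dots> \<approx> (x ^ (p ^ k)) ^ p + (y ^ (p ^ k)) ^ p"
    using assms by (intro frobenius_add power_A)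
  finally show ?case
    by (simp add: mult.commute flip: power_mult)
qed simp

lemma prod_mem_prime:
  assumes "1 \<notin> M" "\<And>x y. x \<in> A \<Longrightarrow> y \<in> A \<Longrightarrow> x * y \<in> M \<Longrightarrow> x \<in> M \<or> y \<in> M"
  shows "finite I \<Longrightarrow> (\<And>i. i \<in> I \<Longrightarrow> f i \<in> A) \<Longrightarrow> prod f I \<in> M \<Longrightarrow> \<exists>i\<in>I. f i \<in> M"
proof (induction I rule: finite_induct)
  case (insert i I)
  have "prod f I \<in> A"
    using insert.hyps(1) insert.prems(1)
    by (induction I rule: finite_induct) (auto intro: one_A mult_A)
  with insert assms(2)[of "f i" "prod f I"] show ?case
    by auto
qed (use assms in simp)

end

section \<open>The ring generated by roots of unity\<close>

text \<open>Only an additive closure is taken: the roots are closed under multiplication, so the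
  group they generate is already a ring.\<close>

inductive_set unity_ring :: "nat \<Rightarrow> complex set" for N :: nat where
  root: "z ^ N = 1 \<Longrightarrow> z \<in> unity_ring N"
| diff: "x \<in> unity_ring N \<Longrightarrow> y \<in> unity_ring N \<Longrightarrow> x - y \<in> unity_ring N"

lemma unity_ring_root_mult:
  "x \<in> unity_ring N \<Longrightarrow> z ^ N = 1 \<Longrightarrow> z * x \<in> unity_ring N"
  by (induction rule: unity_ring.induct)
    (simp_all add: unity_ring.intros power_mult_distrib right_diff_distrib)

lemma unity_ring_mult:
  "x \<in> unity_ring N \<Longrightarrow> y \<in> unity_ring N \<Longrightarrow> x * y \<in> unity_ring N"
  by (induction rule: unity_ring.induct)
    (simp_all add: unity_ring_root_mult unity_ring.intros left_diff_distrib)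

text \<open>Finite generation over the integers, as \<open>divisible_span_imp_zero\<close>
  requires.\<close>

lemma unity_ring_span:
  assumes "N > 0" "x \<in> unity_ring N"
  shows "\<exists>a. x = (\<Sum>z | z ^ N = 1. of_int (a z) * z)"
  using assms(2)
proof (induction rule: unity_ring.induct)
  case (root z)
  have "(\<Sum>w | w ^ N = 1. of_int (if w = z then 1 else 0) * w) = (\<Sum>w | w ^ N = 1. if w = z then z else 0)"
    by (intro sum.cong) auto
  also have "\<dots> = z"
    using root finite_roots_unity[of N, where 'a = complex] assms(1) by (simp add: Suc_leI)
  finally show ?case
    by metis
next
  case (diff x y)
  then obtain a b where "x = (\<Sum>z | z ^ N = 1. of_int (a z) * z)" "y = (\<Sum>z | z ^ N = 1. of_int (b z) * z)"
    by blast
  then have "x - y = (\<Sum>z | z ^ N = 1. of_int (a z - b z) * z)"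
    by (simp add: left_diff_distrib sum_subtractf)
  then show ?case
    by (intro exI[of _ "\<lambda>z. a z - b z"])
qed

text \<open>If \<open>p\<close> had inverse \<open>x\<close>, each root z would equal p (z x) with z
  x an integer combination of roots. Then \<open>divisible_span_imp_zero\<close> would make every
  root zero, including 1. Hence \<open>p\<close> generates a proper ideal.\<close>

lemma prime_not_unit_unity_ring:
  assumes "N > 0" "prime p" "x \<in> unity_ring N"
  shows "of_nat p * x \<noteq> 1"
proof
  assume unit: "of_nat p * x = 1"
  have "\<forall>z\<in>{z::complex. z ^ N = 1}. z = 0"
  proof (rule divisible_span_imp_zero)
    show "finite {z::complex. z ^ N = 1}"
      using assms(1) by (intro finite_roots_unity) simp
    show "prime (int p)"
      using assms(2) by simp
    fix z :: complex assume "z \<in> {z. z ^ N = 1}"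
    then obtain a where "z * x = (\<Sum>z | z ^ N = 1. of_int (a z) * z)"
      using unity_ring_span[OF assms(1) unity_ring_root_mult[OF assms(3)]] by blast
    moreover have "of_nat p * (z * x) = z"
      using unit by (metis mult.left_commute mult.right_neutral)
    ultimately have "of_int 1 * z = of_int (int p) * (\<Sum>z | z ^ N = 1. of_int (a z) * z)"
      by simp
    moreover have "\<not> int p dvd 1"
      using assms(2) by auto
    ultimately show "\<exists>m a. \<not> int p dvd m \<and>
        of_int m * z = of_int (int p) * (\<Sum>z | z ^ N = 1. of_int (a z) * z)"
      by blast
  qed
  then have "(1::complex) = 0"
    by (metis (mono_tags) mem_Collect_eq power_one)
  then show False
    by simp
qed

text \<open>Both sides come from monic polynomials of degree \<open>N\<close> that agree at the
  \<open>N\<close> roots.\<close>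

lemma prod_roots_unity:
  fixes x :: complex
  assumes "N > 0"
  shows "(\<Prod>z | z ^ N = 1. x - z) = x ^ N - 1"
proof -
  let ?U = "{z::complex. z ^ N = 1}" and ?p = "\<Prod>z | z ^ N = 1. [:- z, 1::complex:]"
  have U: "finite ?U" "card ?U = N"
    using assms by (auto intro: finite_roots_unity card_roots_unity_eq)
  have deg: "degree ?p = N"
    using U by (simp add: degree_prod_eq_sum_degree)
  have "?p = monom 1 N - 1"
  proof (rule poly_eqI_degree_lead_coeff[where n = N and A = ?U])
    have "coeff ?p N = lead_coeff ?p"
      by (simp add: deg)
    also have "\<dots> = 1"
      unfolding lead_coeff_prod by simp
    finally show "coeff ?p N = coeff (monom 1 N - 1) N"
      using assms by simp
    show "degree (monom 1 N - 1 :: complex poly) \<le> N"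
      by (intro degree_diff_le) (simp_all add: degree_monom_le)
  qed (use U deg in \<open>auto simp: poly_prod poly_monom\<close>)
  then have "poly ?p x = poly (monom 1 N - 1) x"
    by simp
  then show ?thesis
    by (simp add: poly_prod poly_monom)
qed

text \<open>Take a prime ideal containing \<open>p\<close> in the ring generated by the \<open>(q - 1)\<close>-th roots of unity.
  Distinct roots \<open>z, w\<close> stay distinct modulo it: for \<open>u = w / z \<noteq> 1\<close> the powers of \<open>u\<close> sum to
  \<open>0\<close>, whereas \<open>u\<close> congruent to \<open>1\<close> would make that sum congruent to \<open>q - 1\<close>, i.e. to \<open>-1\<close>.\<close>

lemma ex_residue_field:
  assumes "primepow q" "q mod 4 = 3"
  shows "\<exists>A M K :: complex set. residue_field A M K \<and> card K = q"
proof -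
  obtain p k where p: "prime p" and k: "k > 0" and q: "q = p ^ k"
    using assms(1) unfolding primepow_def by blast
  have "odd q"
    using assms(2) by presburger
  then have "odd p"
    using k by (simp add: q)
  define N where "N = q - 1"
  have N: "N > 0" "q = Suc N"
    using assms(2) by (auto simp: N_def intro!: Nat.gr0I)
  have "even N"
    using \<open>odd q\<close> N by simp
  define A where "A = unity_ring N"
  define U where "U = {z::complex. z ^ N = 1}"
  have U: "finite U" "card U = N"
    using N(1) by (auto simp: U_def intro: finite_roots_unity card_roots_unity_eq)
  have UA: "z \<in> A" if "z \<in> U" for z
    using that unity_ring.root by (auto simp: A_def U_def)
  have one: "1 \<in> A"
    using UA by (simp add: U_def)
  have "subring_ideal A {of_nat p * x | x. x \<in> A}" (is "subring_ideal A ?pA")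
  proof
    have "of_nat n * x \<in> A" if "x \<in> A" for n x
    proof (induction n)
      case 0
      then show ?case
        using unity_ring.diff[of 1 N 1] one by (simp add: A_def)
    next
      case (Suc n)
      have "0 - x \<in> A"
        using that unity_ring.diff[of "1 - 1" N x] unity_ring.diff[of 1 N 1] one by (simp add: A_def)
      with Suc have "of_nat n * x - (0 - x) \<in> A"
        unfolding A_def by (rule unity_ring.diff)
      then show ?case
        by (simp add: algebra_simps)
    qed
    then show "?pA \<subseteq> A"
      by blast
    show "0 \<in> ?pA"
      using unity_ring.diff[of 1 N 1] one by (auto simp: A_def intro!: exI[of _ 0])
    show "x - y \<in> ?pA" if "x \<in> ?pA" "y \<in> ?pA" for x y
      using that unity_ring.diff unfolding A_def by (force simp flip: right_diff_distrib)
    show "a * x \<in> ?pA" if "a \<in> A" "x \<in> ?pA" for a x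
      using that unity_ring_mult unfolding A_def by (force simp: mult.left_commute)
  qed (use one in \<open>auto simp: A_def intro: unity_ring.diff unity_ring_mult\<close>)
  then interpret pA: subring_ideal A ?pA .
  have "1 \<notin> ?pA"
    using prime_not_unit_unity_ring[OF N(1) p] unfolding A_def by force
  then obtain M where M: "subring_ideal A M" "?pA \<subseteq> M" "1 \<notin> M"
    "\<And>x y. x \<in> A \<Longrightarrow> y \<in> A \<Longrightarrow> x * y \<in> M \<Longrightarrow> x \<in> M \<or> y \<in> M"
    using pA.ex_prime_ideal by blast
  interpret subring_ideal A M
    by (rule M)
  have p_M: "of_nat p \<in> M"
    using M(2) one by force
  have q_M: "of_nat q \<in> M"
    using mult_M[OF of_nat_A[of "p ^ (k - 1)"] p_M] k unfolding q
    by (metis of_nat_mult power_minus_mult)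
  \<comment> \<open>Roots satisfy z^q = z exactly, as q = N + 1; the Frobenius congruence extends
    this modulo \<open>M\<close> to differences, using that \<open>q\<close> is odd.\<close>
  have fermat: "x ^ q - x \<in> M" if "x \<in> A" for x
    using that[unfolded A_def]
  proof (induction rule: unity_ring.induct)
    case (root z)
    then show ?case
      by (simp add: N zero_M)
  next
    case (diff x y)
    then have xy: "x \<in> A" "y \<in> A"
      by (simp_all add: A_def)
    have "mcong ((x + - y) ^ q) (x ^ q + (- y) ^ q)"
      unfolding q using p p_M xy minus_A by (intro frobenius_power_add)
    then have "mcong ((x - y) ^ q) (x ^ q - y ^ q)"
      using \<open>odd q\<close> by simp
    also have "mcong \<dots> (x - y)"
      using diff.IH by (intro mcong_diff) (simp_all add: mcong_def)
    finally show ?case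
      by (simp add: mcong_def)
  qed
  \<comment> \<open>Roots of unity are units of \<open>A\<close>, since their inverses are again
    roots.\<close>
  have U_notin: "z \<notin> M" if "z \<in> U" for z
  proof
    assume "z \<in> M"
    moreover have "inverse z \<in> A" and "z \<noteq> 0"
      using that N UA by (auto simp: U_def power_inverse zero_power)
    ultimately show False
      using mult_M[of "inverse z" z] M(3) by simp
  qed
  have one_U: "w = 1" if "w \<in> U" "w - 1 \<in> M" for w
  proof (rule ccontr)
    assume "w \<noteq> 1"
    then have "(\<Sum>i<N. w ^ i) = 0"
      using that(1) by (simp add: geometric_sum U_def)
    moreover have "(\<Sum>i<N. w ^ i - 1) \<in> M"
    proof (rule sum_M)
      fix i
      have "mcong (w ^ i) (1 ^ i)"
        using that UA one_A by (intro mcong_power) (simp_all add: mcong_def)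
      then show "w ^ i - 1 \<in> M"
        by (simp add: mcong_def)
    qed
    ultimately have "- of_nat N \<in> M"
      by (simp add: sum_subtractf)
    then have "of_nat q + - of_nat N \<in> M"
      by (intro add_M q_M)
    then show False
      using M(3) by (simp add: N)
  qed
  have U_inj: "z = w" if "z \<in> U" "w \<in> U" "z - w \<in> M" for z w
  proof -
    have w: "inverse w \<in> U" "w \<noteq> 0"
      using that(2) N by (auto simp: U_def power_inverse zero_power)
    have "inverse w * z - 1 = inverse w * (z - w)"
      using w(2) by (simp add: right_diff_distrib)
    then have "inverse w * z - 1 \<in> M"
      using mult_M[OF UA[OF w(1)] that(3)] by simp
    moreover have "inverse w * z \<in> U"
      using w(1) that(1) by (simp add: U_def power_mult_distrib)
    ultimately have "inverse w * z = 1"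
      using one_U by blast
    then show ?thesis
      using w(2) by (simp add: field_simps)
  qed
  \<comment> \<open>Zero and the \<open>N\<close> roots are the Teichmueller representatives, N + 1
    = q in number.\<close>
  define K where "K = insert 0 U"
  have card_K: "card K = q"
    using U N by (simp add: K_def U_def card_insert_if zero_power)
  have "residue_field A M K"
  proof
    show "1 \<notin> M"
      by (rule M)
    show "x \<in> M \<or> y \<in> M" if "x \<in> A" "y \<in> A" "x * y \<in> M" for x y
      using that by (rule M)
    show "2 \<notin> M"
    proof
      assume "2 \<in> M"
      \<comment> \<open>The odd number \<open>p\<close> and 2 together generate 1.\<close>
      obtain m where "p = 2 * m + 1"
        using \<open>odd p\<close> by (elim oddE)
      then have "of_nat p - of_nat m * 2 = (1::complex)"
        by simp
      moreover have "of_nat p - of_nat m * 2 \<in> M"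
        using \<open>2 \<in> M\<close> p_M of_nat_A by (intro diff_M mult_M)
      ultimately show False
        using M(3) by simp
    qed
    show "finite K" "K \<subseteq> A" "card K mod 4 = 3"
      using U UA zero_A card_K assms(2) by (auto simp: K_def)
    show "x ^ card K - x \<in> M" if "x \<in> A" for x
      using fermat[OF that] by (simp add: card_K)
    show "x = y" if "x \<in> K" "y \<in> K" "x - y \<in> M" for x y
      using that U_inj U_notin minus_M[of "- y"] unfolding K_def by auto
    show "\<exists>z\<in>K. x - z \<in> M" if x: "x \<in> A" for x
    proof (cases "x \<in> M")
      case False
      \<comment> \<open>For \<open>x\<close> outside \<open>M\<close>, primality leaves x^N - 1, the
        product of all x - z over the roots z; so some x - z lies in \<open>M\<close>.\<close>
      have "x * (x ^ N - 1) \<in> M"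
        using fermat[OF x] by (simp add: N algebra_simps)
      then have "x ^ N - 1 \<in> M"
        using False M(4) x diff_A power_A one_A by blast
      then have "(\<Prod>z\<in>U. x - z) \<in> M"
        using prod_roots_unity[OF N(1)] by (simp add: U_def)
      then have "\<exists>z\<in>U. x - z \<in> M"
        using prod_mem_prime[OF M(3,4) U(1)] x UA diff_A by blast
      then show ?thesis
        by (auto simp: K_def)
    qed (auto simp: K_def)
  qed
  with card_K show ?thesis
    by blast
qed

theorem theorem4p3:
  fixes q :: nat
  assumes "primepow q" and "[q = 3] (mod 4)"
  shows "real (ex_number 4 (q + 1) F53) = (real q + 1) / 16 * real ((q + 1) choose 3)"
proof -
  have "q mod 4 = 3"
    using assms(2) by (simp add: cong_def)
  then obtain A M K :: "complex set" where "residue_field A M K" "card K = q"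
    using ex_residue_field assms(1) by blast
  then have "16 * ex_number 4 (q + 1) F53 = (q + 1) * ((q + 1) choose 3)"
    using residue_field.ex_number_F53_card_K by blast
  then have "16 * real (ex_number 4 (q + 1) F53) = (real q + 1) * real ((q + 1) choose 3)"
    by (metis of_nat_1 of_nat_add of_nat_mult of_nat_numeral)
  then show ?thesis
    by simp
qed

end
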